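(* Let $p>2$ and $k\ge1$ be integers and let $\mu$ be a $p$-adic missing digits measure with $k$ missing digits. There exist $\lambda,\Delta\in(0,1)$ such that for all sufficiently large $N$, all but at most $N^{1-\lambda}$ integers $\xi\in[1,N]$ satisfy $|\hat\mu(\xi)|\le\xi^{-\Delta}$. Moreover, if $k$ is fixed and $p$ is large enough, one may choose $\sigma,\epsilon\in(0,1)$ with $1\le\epsilon p\le p-1$ and $2\epsilon k<1$, and take \[ \lambda=\frac{D(\sigma\|1-2\epsilon)}{\log p},\qquad \Delta=\sigma\frac{\log(\epsilon(p-k))}{\log p}. \]
   Context: A $p$-adic missing digits measure with $k$ missing digits is the law of $\sum_{j\ge1}a_jp^{-j}$ where the $a_j$ are i.i.d. uniform on a set $D\subset\{0,\dots,p-1\}$ with $\#D=p-k\ge2$. $\hat\mu(\xi)=\int e^{-2\pi ix\xi}d\mu(x)$. $D(\sigma\|1-2\epsilon)=\sigma\log\frac{\sigma}{1-2\epsilon}+(1-\sigma)\log\frac{1-\sigma}{2\epsilon}$. *)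

theory Defs
  imports "HOL-Probability.Probability"
begin

text \<open>
  The sequence of i.i.d. uniform digits is realised as the coordinate process on the countable
  product of the uniform distributions; coordinate \<open>j\<close> carries the digit \<open>a\<^sub>j\<^sub>+\<^sub>1\<close>.
\<close>

definition digit_law :: "nat \<Rightarrow> nat set \<Rightarrow> real measure" where
  "digit_law p D =
     distr (PiM (UNIV :: nat set) (\<lambda>_. measure_pmf (pmf_of_set D))) borel
       (\<lambda>a. \<Sum>j. real (a j) / real p ^ Suc j)"

definition missing_digits_measure :: "nat \<Rightarrow> nat \<Rightarrow> real measure \<Rightarrow> bool" where
  "missing_digits_measure p k \<mu> \<longleftrightarrow>
     (\<exists>D. D \<subseteq> {0..<p} \<and> card D = p - k \<and> p - k \<ge> 2 \<and> \<mu> = digit_law p D)"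

definition fourier :: "real measure \<Rightarrow> real \<Rightarrow> complex" where
  "fourier \<mu> \<xi> = (CLINT x|\<mu>. exp (- 2 * complex_of_real pi * \<i> * of_real x * of_real \<xi>))"

definition fourier_decay_off_sparse :: "real measure \<Rightarrow> real \<Rightarrow> real \<Rightarrow> bool" where
  "fourier_decay_off_sparse \<mu> lam \<Delta> \<longleftrightarrow>
     (\<forall>\<^sub>F N in sequentially.
        real (card {\<xi> \<in> {1..N}. \<not> norm (fourier \<mu> (real \<xi>)) \<le> real \<xi> powr (- \<Delta>)})
          \<le> real N powr (1 - lam))"

text \<open>The relative entropy of Bernoulli distributions with success probabilities \<open>s\<close> and \<open>q\<close>.\<close>

definition bernoulli_div :: "real \<Rightarrow> real \<Rightarrow> real" where
  "bernoulli_div s q = s * ln (s / q) + (1 - s) * ln ((1 - s) / (1 - q))"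

end

theory Submission
  imports Defs
begin

text \<open>
  The modulus of the Fourier transform at \<open>\<xi> < p\<^sup>n\<close> is at most the product of \<open>f (\<xi> / p\<^sup>j)\<close> for
  \<open>1 \<le> j \<le> n\<close>, where \<open>f\<close> is the modulus of the exponential sum averaged over the digit set. As \<open>f\<close> has
  period 1, a bound \<open>K\<close> on the sum of \<open>f ((a + t) / p)\<^sup>s\<close> over the digits \<open>a\<close>, uniform in \<open>t\<close>, bounds the sum over
  \<open>\<xi> < p\<^sup>n\<close> of the \<open>s\<close>-th powers of these products by \<open>K\<^sup>n\<close>, and Markov's inequality bounds the
  number of exceptional \<open>\<xi>\<close>.

  For general \<open>p\<close> take \<open>s = 2\<close>, where Parseval's identity gives \<open>K = p / #D < p\<close>. For large \<open>p\<close>, \<open>f\<close> is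
  smaller than \<open>1 / (\<epsilon> (p - k))\<close> at distance at least \<open>\<epsilon>\<close> from the integers, and optimising over \<open>s\<close> is
  the Chernoff bound behind the relative entropy. That the bound on \<open>f\<close> is strict saves an
  exponential factor, which absorbs the constant lost when \<open>N\<close> lies between two powers of \<open>p\<close>.
\<close>

section \<open>The averaged exponential sum over the digit set\<close>

definition digit_factor :: "nat set \<Rightarrow> real \<Rightarrow> real" where
  "digit_factor D t = norm (\<Sum>d\<in>D. cis (2 * pi * real d * t)) / real (card D)"

lemma digit_factor_nonneg: "0 \<le> digit_factor D t"
  by (simp add: digit_factor_def)

lemma norm_sum_cis_le: "norm (\<Sum>d\<in>D. cis (f d)) \<le> real (card D)"
  by (rule order_trans[OF norm_sum]) simp

lemma digit_factor_le_1: "digit_factor D t \<le> 1"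
  using norm_sum_cis_le[of "\<lambda>d. 2 * pi * real d * t" D]
  by (cases "card D = 0") (simp_all add: digit_factor_def divide_simps)

lemma cis_add_2pi_of_nat: "cis (x + 2 * pi * real n) = cis x"
  by (simp flip: cis_mult)

lemma digit_factor_add_nat: "digit_factor D (t + real m) = digit_factor D t"
proof -
  have "cis (2 * pi * real d * (t + real m)) = cis (2 * pi * real d * t)" for d
    using cis_add_2pi_of_nat[of "2 * pi * real d * t" "d * m"] by (simp add: algebra_simps)
  then show ?thesis
    by (simp add: digit_factor_def)
qed

text \<open>The Fourier transform carries a minus sign in the exponent and
  \<open>digit_factor\<close> does not; conjugation links the two.\<close>

lemma norm_sum_cis_uminus: "norm (\<Sum>d\<in>D. cis (- f d)) = norm (\<Sum>d\<in>D. cis (f d))"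
proof -
  have "(\<Sum>d\<in>D. cis (- f d)) = cnj (\<Sum>d\<in>D. cis (f d))"
    by (simp add: cis_cnj)
  then show ?thesis
    by (metis complex_mod_cnj)
qed

subsection \<open>The Fourier transform as an infinite product\<close>

lemma summable_digit_expansion:
  assumes p: "p \<ge> 2" and a: "\<And>j. a j \<le> (p::nat)"
  shows "summable (\<lambda>j. real (a j) / real p ^ Suc j)"
proof (rule summable_comparison_test')
  show "summable (\<lambda>j. (1 / real p) ^ j)"
    using p by (intro summable_geometric) auto
  show "norm (real (a j) / real p ^ Suc j) \<le> (1 / real p) ^ j" for j
    using p a[of j] by (simp add: field_simps)
qed

context
  fixes D :: "nat set" and p :: nat
  assumes D: "finite D" "D \<noteq> {}"
begin

interpretation product_prob_space "\<lambda>_::nat. measure_pmf (pmf_of_set D)" UNIV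
  by unfold_locales

abbreviation digit_seq_law :: "(nat \<Rightarrow> nat) measure" where
  "digit_seq_law \<equiv> PiM UNIV (\<lambda>_. measure_pmf (pmf_of_set D))"

lemma measurable_digit [measurable]: "(\<lambda>a. real (a j)) \<in> borel_measurable digit_seq_law"
proof -
  have "(\<lambda>a. a j) \<in> measurable digit_seq_law (measure_pmf (pmf_of_set D))"
    by (rule measurable_component_singleton) simp
  then show ?thesis
    by (rule measurable_compose) simp
qed

lemma AE_digits: "AE a in digit_seq_law. \<forall>j. a j \<in> D"
proof (subst AE_all_countable, rule allI)
  fix j
  show "AE a in digit_seq_law. a j \<in> D"
    using D by (intro AE_PiM_component) (auto simp: prob_space_measure_pmf AE_measure_pmf_iff)
qed

text \<open>Independence of the digits: the integrand sees only the first \<open>n\<close>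
  coordinates, so the integral passes to a finite product space, where it factors.\<close>

lemma integral_prod_digits:
  fixes g :: "nat \<Rightarrow> nat \<Rightarrow> complex"
  assumes g: "\<And>i d. norm (g i d) \<le> 1"
  shows "(LINT a|digit_seq_law. (\<Prod>i<n. g i (a i))) = (\<Prod>i<n. (\<Sum>d\<in>D. g i d) / of_nat (card D))"
proof -
  let ?M = "\<lambda>_::nat. measure_pmf (pmf_of_set D)"
  have meas: "(\<lambda>a. \<Prod>i<n. g i (a i)) \<in> borel_measurable (PiM {..<n} ?M)"
  proof (rule borel_measurable_prod)
    fix i assume "i \<in> {..<n}"
    then have "(\<lambda>a. a i) \<in> measurable (PiM {..<n} ?M) (?M i)"
      by (rule measurable_component_singleton)
    then show "(\<lambda>a. g i (a i)) \<in> borel_measurable (PiM {..<n} ?M)"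
      by (rule measurable_compose) simp
  qed
  have "(LINT a|digit_seq_law. (\<Prod>i<n. g i (a i)))
      = (LINT a|digit_seq_law. (\<Prod>i<n. g i (restrict a {..<n} i)))"
    by (intro Bochner_Integration.integral_cong) (auto intro!: prod.cong)
  also have "\<dots> = (LINT a|distr digit_seq_law (PiM {..<n} ?M) (\<lambda>x. restrict x {..<n}).
                     (\<Prod>i<n. g i (a i)))"
    using meas by (subst integral_distr) (auto intro!: measurable_restrict_subset)
  also have "\<dots> = (LINT a|PiM {..<n} ?M. (\<Prod>i<n. g i (a i)))"
    by (subst distr_PiM_restrict_finite) auto
  also have "\<dots> = (\<Prod>i<n. LINT d|measure_pmf (pmf_of_set D). g i d)"
    using g by (intro product_integral_prod measure_pmf.integrable_const_bound[where B = 1]) auto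
  also have "\<dots> = (\<Prod>i<n. (\<Sum>d\<in>D. g i d) / of_nat (card D))"
    using D by (intro prod.cong refl)
      (subst integral_measure_pmf[of D],
       auto simp: sum_divide_distrib scaleR_conv_of_real)
  finally show ?thesis .
qed

lemma norm_fourier_digit_law_le:
  assumes p: "p \<ge> 2" and Dp: "D \<subseteq> {0..<p}"
  shows "norm (fourier (digit_law p D) \<xi>) \<le> (\<Prod>j<n. digit_factor D (\<xi> / real p ^ Suc j))"
proof -
  let ?x = "\<lambda>a::nat \<Rightarrow> nat. \<Sum>j. real (a j) / real p ^ Suc j"
  define h where "h = (\<lambda>m (a::nat \<Rightarrow> nat).
    \<Prod>j<m. cis (- (2 * pi * real (a j) * (\<xi> / real p ^ Suc j))))"
  have h_eq: "h m a = cis (- (2 * pi * \<xi>) * (\<Sum>j<m. real (a j) / real p ^ Suc j))" for m a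
    by (induction m) (simp_all add: h_def cis_mult algebra_simps)
  have cis_measurable [measurable]: "cis \<in> borel_measurable borel"
    by (intro borel_measurable_continuous_onI continuous_intros)
  have x_measurable [measurable]: "?x \<in> borel_measurable digit_seq_law"
    by measurable
  have "fourier (digit_law p D) \<xi> = (LINT x|digit_law p D. cis (- (2 * pi * \<xi>) * x))"
    unfolding fourier_def
    by (intro Bochner_Integration.integral_cong) (auto simp: cis_conv_exp algebra_simps)
  also have "\<dots> = (LINT a|digit_seq_law. cis (- (2 * pi * \<xi>) * ?x a))"
    unfolding digit_law_def by (subst integral_distr) simp_all
  finally have fourier_eq:
    "fourier (digit_law p D) \<xi> = (LINT a|digit_seq_law. cis (- (2 * pi * \<xi>) * ?x a))" .
  have "(\<lambda>m. LINT a|digit_seq_law. h m a) \<longlonglongrightarrow> fourier (digit_law p D) \<xi>"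
    unfolding fourier_eq
  proof (rule integral_dominated_convergence[where w = "\<lambda>_. 1"])
    \<comment> \<open>Off the almost sure event that all digits lie in \<open>D\<close> the series
      may diverge, and its sum is then a default value.\<close>
    show "AE a in digit_seq_law. (\<lambda>m. h m a) \<longlonglongrightarrow> cis (- (2 * pi * \<xi>) * ?x a)"
      using AE_digits
    proof eventually_elim
      case (elim a)
      then have "a j \<le> p" for j
        using Dp by (force dest: spec[of _ j])
      then have "(\<lambda>m. \<Sum>j<m. real (a j) / real p ^ Suc j) \<longlonglongrightarrow> ?x a"
        by (intro summable_LIMSEQ summable_digit_expansion p)
      then show ?case
        unfolding h_eq by (intro tendsto_intros)
    qed
    show "(\<lambda>a. h m a) \<in> borel_measurable digit_seq_law" for m
      unfolding h_eq by measurable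
  qed (simp_all add: h_eq)
  moreover have "norm (LINT a|digit_seq_law. h m a) \<le> (\<Prod>j<n. digit_factor D (\<xi> / real p ^ Suc j))"
    if "m \<ge> n" for m
  proof -
    have "(LINT a|digit_seq_law. h m a) =
        (\<Prod>j<m. (\<Sum>d\<in>D. cis (- (2 * pi * real d * (\<xi> / real p ^ Suc j)))) / of_nat (card D))"
      unfolding h_def by (rule integral_prod_digits) simp
    then have "norm (LINT a|digit_seq_law. h m a) = (\<Prod>j<m. digit_factor D (\<xi> / real p ^ Suc j))"
      by (simp add: prod_norm[symmetric] digit_factor_def norm_divide norm_sum_cis_uminus)
    also have "\<dots> \<le> (\<Prod>j<n. digit_factor D (\<xi> / real p ^ Suc j))"
      using that
    proof (induction m rule: dec_induct)
      case (step m)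
      have "(\<Prod>j<Suc m. digit_factor D (\<xi> / real p ^ Suc j))
          \<le> (\<Prod>j<m. digit_factor D (\<xi> / real p ^ Suc j))"
        unfolding prod.lessThan_Suc
        by (intro mult_left_le digit_factor_le_1 prod_nonneg ballI digit_factor_nonneg)
      then show ?case
        using step.IH by (rule order_trans)
    qed simp
    finally show ?thesis .
  qed
  ultimately show ?thesis
    by (intro tendsto_upperbound[OF tendsto_norm])
      (auto intro: eventually_sequentiallyI[of n] simp del: power_Suc)
qed

end

subsection \<open>Moments of the product over one period\<close>

text \<open>Induction on \<open>n\<close>, splitting off the leading digit \<open>a\<close> of
  \<open>a * p ^ n + x\<close>: by periodicity \<open>a\<close> enters only the last factor, so the
  inner sum over \<open>a\<close> is the one bounded by \<open>K\<close>, with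
  \<open>t = x / p ^ n\<close>.\<close>

lemma sum_prod_digits_le:
  fixes g :: "real \<Rightarrow> real"
  assumes p: "p > 0"
    and nonneg: "\<And>t. 0 \<le> g t"
    and periodic: "\<And>t m. g (t + real m) = g t"
    and K: "\<And>t. 0 \<le> t \<Longrightarrow> t < 1 \<Longrightarrow> (\<Sum>a<p. g ((real a + t) / real p)) \<le> K"
  shows "(\<Sum>x<p ^ n. \<Prod>j<n. g (real x / real p ^ Suc j)) \<le> K ^ n"
proof (induction n)
  case (Suc n)
  have K0: "0 \<le> K"
    using K[of 0] by (meson nonneg order_trans sum_nonneg zero_le_one order_refl zero_less_one)
  let ?P = "\<lambda>x. \<Prod>j<n. g (real x / real p ^ Suc j)"
  have shift: "(\<Prod>j<Suc n. g (real (a * p ^ n + x) / real p ^ Suc j)) =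
      ?P x * g ((real a + real x / real p ^ n) / real p)" for a x
  proof -
    have "g (real (a * p ^ n + x) / real p ^ Suc j) = g (real x / real p ^ Suc j)" if "j < n" for j
    proof -
      have "real p ^ n = real p ^ Suc j * real p ^ (n - Suc j)"
        using that by (metis Suc_leI le_add_diff_inverse power_add)
      then have "real (a * p ^ n + x) / real p ^ Suc j = real x / real p ^ Suc j + real (a * p ^ (n - Suc j))"
        using p by (simp add: field_simps del: power_Suc)
      then show ?thesis
        by (simp only: periodic)
    qed
    moreover have "real (a * p ^ n + x) / real p ^ Suc n = (real a + real x / real p ^ n) / real p"
      using p by (simp add: field_simps)
    ultimately show ?thesis
      by simp
  qed
  have "(\<Sum>x<p ^ Suc n. \<Prod>j<Suc n. g (real x / real p ^ Suc j)) =
      (\<Sum>a<p. \<Sum>x\<in>{a * p ^ n..<a * p ^ n + p ^ n}. \<Prod>j<Suc n. g (real x / real p ^ Suc j))"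
    by (subst sum.nat_group) simp
  also have "\<dots> = (\<Sum>a<p. \<Sum>x<p ^ n. \<Prod>j<Suc n. g (real (a * p ^ n + x) / real p ^ Suc j))"
    by (rule sum.cong[OF refl], subst sum.atLeastLessThan_shift_0)
      (simp add: atLeast0LessThan comp_def del: prod.lessThan_Suc)
  also have "\<dots> = (\<Sum>x<p ^ n. ?P x * (\<Sum>a<p. g ((real a + real x / real p ^ n) / real p)))"
    by (subst sum.swap) (simp only: shift sum_distrib_left)
  also have "\<dots> \<le> (\<Sum>x<p ^ n. ?P x * K)"
  proof (intro sum_mono mult_left_mono K prod_nonneg nonneg ballI)
    fix x assume "x \<in> {..<p ^ n}"
    then have "real x < real p ^ n"
      by (simp flip: of_nat_power)
    then show "real x / real p ^ n < 1"
      using p by simp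
  qed auto
  also have "\<dots> \<le> K ^ n * K"
    unfolding sum_distrib_right[symmetric] using Suc K0 by (rule mult_right_mono)
  finally show ?case
    by (simp add: mult.commute)
qed simp

lemma card_large_prod_le:
  fixes g :: "real \<Rightarrow> real"
  assumes p: "p > 1" and s: "s > 0"
    and nonneg: "\<And>t. 0 \<le> g t"
    and periodic: "\<And>t m. g (t + real m) = g t"
    and K: "\<And>t. 0 \<le> t \<Longrightarrow> t < 1 \<Longrightarrow> (\<Sum>a<p. g ((real a + t) / real p) powr s) \<le> K"
  shows "real (card {x\<in>{..<p ^ n}. real p powr (- \<Delta> * n) < (\<Prod>j<n. g (real x / real p ^ Suc j))})
           \<le> (real p powr (\<Delta> * s) * K) ^ n"
proof -
  let ?Q = "\<lambda>x. \<Prod>j<n. g (real x / real p ^ Suc j)"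
  let ?B = "{x\<in>{..<p ^ n}. real p powr (- \<Delta> * n) < ?Q x}"
  \<comment> \<open>\<open>c\<close> is the inverse of the \<open>s\<close>-th power of the
    threshold, so \<open>c * ?Q x powr s\<close> is at least 1 on \<open>?B\<close>.\<close>
  define c where "c = real p powr (\<Delta> * s * n)"
  have "real (card ?B) = (\<Sum>x\<in>?B. 1)"
    by simp
  also have "\<dots> \<le> (\<Sum>x\<in>?B. c * ?Q x powr s)"
  proof (rule sum_mono)
    fix x assume "x \<in> ?B"
    then have "(real p powr (- \<Delta> * n)) powr s \<le> ?Q x powr s"
      using s by (intro powr_mono2) auto
    then have "c * (real p powr (- \<Delta> * n)) powr s \<le> c * ?Q x powr s"
      by (intro mult_left_mono) (auto simp: c_def)
    moreover have "c * (real p powr (- \<Delta> * n)) powr s = 1"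
      using p by (simp add: c_def powr_powr mult_ac flip: powr_add)
    ultimately show "1 \<le> c * ?Q x powr s"
      by simp
  qed
  also have "\<dots> \<le> (\<Sum>x<p ^ n. c * ?Q x powr s)"
    by (intro sum_mono2) (auto simp: c_def)
  also have "\<dots> = c * (\<Sum>x<p ^ n. \<Prod>j<n. g (real x / real p ^ Suc j) powr s)"
    by (simp add: sum_distrib_left prod_powr_distrib)
  also have "\<dots> \<le> c * K ^ n"
    using p by (intro mult_left_mono sum_prod_digits_le[where g = "\<lambda>t. g t powr s"])
      (auto simp: c_def periodic K)
  also have "c = (real p powr (\<Delta> * s)) ^ n"
    using p by (simp add: c_def powr_powr flip: powr_realpow)
  finally show ?thesis
    by (simp add: power_mult_distrib)
qed

text \<open>Each further digit multiplies the bound of \<open>card_large_prod_le\<close> by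
  \<open>p powr (\<Delta> * s) * K\<close>; \<open>gap\<close> puts this rate strictly below
  \<open>p powr (1 - lam)\<close>, which leaves room for a constant factor.\<close>

lemma fourier_decay_off_sparse_digit_law:
  assumes D: "finite D" "D \<noteq> {}" "D \<subseteq> {0..<p}" and p: "p \<ge> 2"
    and s: "s > 0" and \<Delta>: "\<Delta> > 0" and lam: "lam < 1"
    and K: "\<And>t. 0 \<le> t \<Longrightarrow> t < 1 \<Longrightarrow> (\<Sum>a<p. digit_factor D ((real a + t) / real p) powr s) \<le> K"
    and gap: "real p powr (\<Delta> * s) * K < real p powr (1 - lam)"
  shows "fourier_decay_off_sparse (digit_law p D) lam \<Delta>"
proof -
  \<comment> \<open>The maximum with 1 makes \<open>\<rho>\<close> nonnegative, so that
    \<open>p ^ m\<close> may later be replaced by \<open>N\<close>; the strict gap survives because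
    \<open>lam < 1\<close>.\<close>
  define M where "M = max 1 (real p powr (\<Delta> * s) * K)"
  define \<rho> where "\<rho> = log (real p) M"
  have M1: "1 \<le> M" and M: "real p powr \<rho> = M"
    using p by (auto simp: M_def \<rho>_def)
  have "M < real p powr (1 - lam)"
    using gap p lam by (auto simp: M_def intro!: gr_one_powr)
  then have \<rho>: "0 \<le> \<rho>" "\<rho> < 1 - lam"
    using p M1 by (auto simp: \<rho>_def log_less_iff)
  have K0: "0 \<le> K"
    using K[of 0] by (meson powr_ge_zero order_trans sum_nonneg zero_le_one order_refl zero_less_one)
  have bound: "real (card {\<xi> \<in> {1..N}. \<not> norm (fourier (digit_law p D) (real \<xi>)) \<le> real \<xi> powr (- \<Delta>)})
      \<le> M * real N powr \<rho>" if N: "N \<ge> 1" for N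
  proof -
    obtain m where m: "p ^ m \<le> N" "N < p ^ Suc m"
      using ex_power_ivl1[of p N] p N by auto
    \<comment> \<open>All \<open>\<xi> \<le> N\<close> have at most \<open>m + 1\<close> digits in
      base \<open>p\<close>; the digit beyond \<open>m\<close> costs one factor
      \<open>M\<close>.\<close>
    let ?n = "Suc m"
    have M_pow: "M ^ m = real (p ^ m) powr \<rho>"
      unfolding M[symmetric] using p by (simp add: powr_def ln_realpow mult.left_commute flip: exp_of_nat_mult)
    let ?A = "{\<xi> \<in> {1..N}. \<not> norm (fourier (digit_law p D) (real \<xi>)) \<le> real \<xi> powr (- \<Delta>)}"
    let ?B = "{x\<in>{..<p ^ ?n}. real p powr (- \<Delta> * ?n) < (\<Prod>j<?n. digit_factor D (real x / real p ^ Suc j))}"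
    have "?A \<subseteq> ?B"
    proof
      fix x assume x: "x \<in> ?A"
      then have "x < p ^ ?n"
        using m by auto
      moreover have "real p powr (- \<Delta> * ?n) < (\<Prod>j<?n. digit_factor D (real x / real p ^ Suc j))"
      proof -
        have "real x \<le> real p powr ?n"
          using \<open>x < p ^ ?n\<close> p of_nat_mono[of x "p ^ ?n", where 'a = real]
          by (simp add: powr_realpow del: power_Suc of_nat_Suc)
        then have "(real p powr ?n) powr (- \<Delta>) \<le> real x powr (- \<Delta>)"
          using x \<Delta> by (intro powr_mono2') auto
        also have "\<dots> < norm (fourier (digit_law p D) (real x))"
          using x by simp
        also have "\<dots> \<le> (\<Prod>j<?n. digit_factor D (real x / real p ^ Suc j))"
          by (rule norm_fourier_digit_law_le[OF D(1,2) p D(3)])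
        finally show ?thesis
          by (simp add: powr_powr mult.commute)
      qed
      ultimately show "x \<in> ?B"
        by simp
    qed
    then have "real (card ?A) \<le> real (card ?B)"
      by (intro of_nat_mono card_mono) auto
    also have "\<dots> \<le> (real p powr (\<Delta> * s) * K) ^ ?n"
      using p s K by (intro card_large_prod_le) (auto simp: digit_factor_nonneg digit_factor_add_nat)
    also have "\<dots> \<le> M ^ ?n"
      using K0 by (intro power_mono) (auto simp: M_def)
    also have "M ^ ?n = M * real (p ^ m) powr \<rho>"
      using M_pow by simp
    also have "\<dots> \<le> M * real N powr \<rho>"
      using m M1 \<rho> by (intro mult_left_mono powr_mono2) simp_all
    finally show ?thesis .
  qed
  \<comment> \<open>The exponent is positive, so this power of \<open>N\<close> eventually exceeds
    the lost factor \<open>M\<close>.\<close>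
  have "filterlim (\<lambda>N. real N powr (1 - lam - \<rho>)) at_top sequentially"
    using \<rho> by real_asymp
  then have "\<forall>\<^sub>F N in sequentially. M \<le> real N powr (1 - lam - \<rho>)"
    by (simp add: filterlim_at_top)
  then show ?thesis
    unfolding fourier_decay_off_sparse_def using eventually_ge_at_top[of 1]
  proof eventually_elim
    case (elim N)
    then have "M * real N powr \<rho> \<le> real N powr (1 - lam - \<rho>) * real N powr \<rho>"
      by (intro mult_right_mono) auto
    then show ?case
      using bound[of N] elim by (simp flip: powr_add)
  qed
qed

subsection \<open>Two bounds for a single digit\<close>

text \<open>A geometric sum over the powers of a \<open>p\<close>-th root of unity other than
  1.\<close>

lemma sum_cis_multiples_eq_0:
  assumes p: "p > 0" and m: "\<not> int p dvd m"
  shows "(\<Sum>a<p. cis (2 * pi * real_of_int m * real a / real p)) = 0"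
proof -
  let ?z = "cis (2 * pi * real_of_int m / real p)"
  have "?z ^ p = cis (2 * pi * real_of_int m)"
    using p by (simp add: Complex.DeMoivre)
  then have "?z ^ p = 1"
    by (simp add: cis_multiple_2pi)
  moreover have "?z \<noteq> 1"
  proof
    assume "?z = 1"
    then obtain k :: int where "2 * pi * real_of_int m / real p = real_of_int (2 * k) * pi"
      by (auto simp: complex_eq_iff cos_one_2pi_int algebra_simps)
    then have "real_of_int m = real_of_int (int p * k)"
      using p by (simp add: field_simps)
    then show False
      using m by (metis of_int_eq_iff dvd_triv_left)
  qed
  ultimately have "(\<Sum>a<p. ?z ^ a) = 0"
    by (simp add: geometric_sum)
  then show ?thesis
    by (simp add: Complex.DeMoivre mult_ac)
qed

text \<open>Parseval: the squared modulus expands into pairs of digits. Distinct digits differ by a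
  non-multiple of \<open>p\<close>, so their terms cancel in the sum over \<open>a\<close>; the
  shift \<open>t\<close> only adds a phase. The diagonal leaves \<open>card D * p\<close>.\<close>

lemma sum_digit_factor_squares:
  assumes D: "D \<noteq> {}" "D \<subseteq> {0..<p}"
  shows "(\<Sum>a<p. (digit_factor D ((real a + t) / real p))\<^sup>2) = real p / real (card D)"
proof -
  have p: "p > 0" and fin: "finite D" and card: "card D > 0"
    using D by (auto intro: finite_subset simp: card_gt_0_iff)
  let ?S = "\<lambda>x. \<Sum>d\<in>D. cis (2 * pi * real d * x)"
  have S: "complex_of_real ((norm (?S x))\<^sup>2) = (\<Sum>d\<in>D. \<Sum>e\<in>D. cis (2 * pi * (real d - real e) * x))" for x
    unfolding complex_norm_square
    by (simp add: sum_product cis_cnj cis_mult algebra_simps)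
  have ortho: "(\<Sum>a<p. cis (2 * pi * (real d - real e) * ((real a + t) / real p))) = (if d = e then of_nat p else 0)"
    if "d \<in> D" "e \<in> D" for d e
  proof (cases "d = e")
    case False
    have "d < p" "e < p"
      using that D by auto
    then have "\<bar>int d - int e\<bar> < int p" "int d - int e \<noteq> 0"
      using False by auto
    then have "\<not> int p dvd (int d - int e)"
      using dvd_imp_le_int[of "int d - int e" "int p"] by auto
    then have "(\<Sum>a<p. cis (2 * pi * real_of_int (int d - int e) * real a / real p)) = 0"
      using p by (intro sum_cis_multiples_eq_0)
    then have "0 = cis (2 * pi * (real d - real e) * (t / real p)) * (\<Sum>a<p. cis (2 * pi * real_of_int (int d - int e) * real a / real p))"
      by simp
    also have "\<dots> = (\<Sum>a<p. cis (2 * pi * (real d - real e) * ((real a + t) / real p)))"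
      unfolding sum_distrib_left cis_mult
      by (intro sum.cong refl arg_cong[where f = cis]) (use p in \<open>simp add: field_simps\<close>)
    finally show ?thesis
      using False by simp
  qed simp
  have "complex_of_real (\<Sum>a<p. (norm (?S ((real a + t) / real p)))\<^sup>2) =
      (\<Sum>d\<in>D. \<Sum>e\<in>D. \<Sum>a<p. cis (2 * pi * (real d - real e) * ((real a + t) / real p)))"
    unfolding of_real_sum S by (rule trans[OF sum.swap], rule sum.cong[OF refl], rule sum.swap)
  also have "\<dots> = (\<Sum>d\<in>D. \<Sum>e\<in>D. if d = e then of_nat p else 0)"
    by (intro sum.cong refl ortho)
  also have "\<dots> = complex_of_real (real (card D * p))"
    using fin by simp
  finally have "(\<Sum>a<p. (norm (?S ((real a + t) / real p)))\<^sup>2) = real (card D * p)"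
    by (rule of_real_eq_iff[THEN iffD1])
  then show ?thesis
    using card by (simp add: digit_factor_def power_divide power2_eq_square flip: sum_divide_distrib)
qed

text \<open>Jordan's inequality: the concave sine lies above its chord from 0 to
  \<open>pi / 2\<close>; the reflection of \<open>t\<close> to \<open>1 - t\<close> covers the other
  half.\<close>

lemma sin_pi_mult_ge:
  assumes "0 \<le> \<epsilon>" "\<epsilon> \<le> t" "t \<le> 1 - \<epsilon>"
  shows "2 * \<epsilon> \<le> sin (pi * t)"
proof -
  have jordan: "2 * x \<le> sin (pi * x)" if "0 \<le> x" "x \<le> 1 / 2" for x :: real
  proof -
    have "convex_on {0..pi} (\<lambda>x. - sin x)"
      by (rule f''_ge0_imp_convex[where f' = "\<lambda>x. - cos x" and f'' = sin])
        (auto intro!: derivative_eq_intros sin_ge_zero)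
    then have "- sin ((1 - 2 * x) *\<^sub>R 0 + (2 * x) *\<^sub>R (pi / 2)) \<le> (1 - 2 * x) * (- sin 0) + (2 * x) * (- sin (pi / 2))"
      using that by (intro convex_onD) auto
    then show ?thesis
      by (simp add: mult.commute)
  qed
  show ?thesis
  proof (cases "t \<le> 1 / 2")
    case True
    then show ?thesis
      using jordan[of t] assms by simp
  next
    case False
    then show ?thesis
      using jordan[of "1 - t"] assms by (simp add: algebra_simps sin_diff)
  qed
qed

text \<open>In the closed form of the geometric sum the numerator has modulus at most 2 and the
  denominator \<open>2 * sin (pi * t)\<close>, which is at least
  \<open>4 * \<epsilon>\<close>.\<close>

lemma norm_sum_cis_geometric_le:
  assumes \<epsilon>: "0 < \<epsilon>" "\<epsilon> \<le> t" "t \<le> 1 - \<epsilon>"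
  shows "norm (\<Sum>d<p. cis (2 * pi * real d * t)) \<le> 1 / (2 * \<epsilon>)"
proof -
  let ?z = "cis (2 * pi * t)"
  have sin: "2 * \<epsilon> \<le> sin (pi * t)"
    using \<epsilon> by (intro sin_pi_mult_ge) auto
  have norm_z: "norm (?z - 1) = 2 * sin (pi * t)"
    using dist_exp_i_1[of "2 * pi * t"] sin \<epsilon> by (simp add: cis_conv_exp)
  then have "?z \<noteq> 1"
    using sin \<epsilon> by auto
  have "(\<Sum>d<p. cis (2 * pi * real d * t)) = (\<Sum>d<p. ?z ^ d)"
    by (intro sum.cong refl) (simp add: Complex.DeMoivre mult_ac)
  also have "\<dots> = (?z ^ p - 1) / (?z - 1)"
    using \<open>?z \<noteq> 1\<close> by (rule geometric_sum)
  finally have "norm (\<Sum>d<p. cis (2 * pi * real d * t)) = norm (?z ^ p - 1) / (2 * sin (pi * t))"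
    by (simp add: norm_divide norm_z)
  also have "\<dots> \<le> 2 / (2 * (2 * \<epsilon>))"
    using sin \<epsilon> norm_triangle_ineq4[of "?z ^ p" 1] by (intro frac_le) (auto simp: norm_power)
  finally show ?thesis
    by simp
qed

text \<open>Comparison with the geometric sum over all \<open>p\<close> digits: the \<open>k\<close>
  missing terms contribute at most \<open>k\<close>.\<close>

lemma digit_factor_le:
  assumes D: "D \<subseteq> {0..<p}" "card D = p - k" "k < p"
    and \<epsilon>: "0 < \<epsilon>" "\<epsilon> \<le> t" "t \<le> 1 - \<epsilon>"
  shows "digit_factor D t \<le> (1 / (2 * \<epsilon>) + real k) / (real p - real k)"
proof -
  let ?e = "\<lambda>d::nat. cis (2 * pi * real d * t)"
  have fin: "finite D"
    using D by (auto intro: finite_subset)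
  have card: "card ({..<p} - D) = k"
    using D fin by (subst card_Diff_subset) auto
  have "(\<Sum>d\<in>D. ?e d) = (\<Sum>d<p. ?e d) - (\<Sum>d\<in>{..<p} - D. ?e d)"
    using D by (subst sum_diff) (auto simp: atLeast0LessThan)
  then have "norm (\<Sum>d\<in>D. ?e d) \<le> norm (\<Sum>d<p. ?e d) + norm (\<Sum>d\<in>{..<p} - D. ?e d)"
    by (metis norm_triangle_ineq4)
  also have "\<dots> \<le> 1 / (2 * \<epsilon>) + real k"
    using norm_sum_cis_geometric_le[OF \<epsilon>] norm_sum_cis_le[of _ "{..<p} - D"] card
    by (intro add_mono) auto
  finally show ?thesis
    using D by (simp add: digit_factor_def of_nat_diff divide_right_mono)
qed

subsection \<open>Choice of parameters\<close>

lemma missing_digits_decay: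
  assumes p: "p > 2" and k: "k \<ge> 1" and \<mu>: "missing_digits_measure p k \<mu>"
  shows "\<exists>lam\<in>{0<..<1}. \<exists>\<Delta>\<in>{0<..<1}. fourier_decay_off_sparse \<mu> lam \<Delta>"
proof -
  obtain D where D: "D \<subseteq> {0..<p}" "card D = p - k" "p - k \<ge> 2" "\<mu> = digit_law p D"
    using \<mu> by (auto simp: missing_digits_measure_def)
  \<comment> \<open>Write \<open>card D = p powr L\<close>. With \<open>s = 2\<close> and both
    exponents equal to \<open>\<delta>\<close>, the gap condition reads
    \<open>2 * \<delta> + 1 - L < 1 - \<delta>\<close>, which \<open>\<delta> = L / 4\<close>
    satisfies.\<close>
  define \<delta> where "\<delta> = log (real p) (real (card D)) / 4"
  have "log (real p) (real (card D)) < log (real p) (real p)"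
    using D p k by (intro log_less) auto
  then have "log (real p) (real (card D)) < 1"
    using p by simp
  moreover have "0 < log (real p) (real (card D))"
    using D p by simp
  ultimately have \<delta>: "0 < \<delta>" "\<delta> < 1"
    unfolding \<delta>_def by linarith+
  have "fourier_decay_off_sparse (digit_law p D) \<delta> \<delta>"
  proof (rule fourier_decay_off_sparse_digit_law[where s = 2 and K = "real p / real (card D)"])
    show "(\<Sum>a<p. digit_factor D ((real a + t) / real p) powr 2) \<le> real p / real (card D)" for t
      using sum_digit_factor_squares[of D p t] D by (cases "D = {}") (auto simp: digit_factor_nonneg)
    have "real (card D) = real p powr (4 * \<delta>)"
      using D p by (simp add: \<delta>_def)
    then have "real p powr (\<delta> * 2) * (real p / real (card D)) = real p powr (1 - 2 * \<delta>)"
      using p by (simp add: powr_diff flip: powr_add)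
        (simp add: field_simps flip: powr_add)
    then show "real p powr (\<delta> * 2) * (real p / real (card D)) < real p powr (1 - \<delta>)"
      using p \<delta> by simp
  qed (use D p \<delta> in \<open>auto intro: finite_subset\<close>)
  then show ?thesis
    using \<delta> D by (intro bexI[of _ \<delta>]) auto
qed

text \<open>This closed form makes \<open>p powr (- lam)\<close> algebraic in
  \<open>\<epsilon>\<close> when \<open>\<sigma> = 1 / 2\<close>.\<close>

lemma bernoulli_div_half:
  assumes "0 < q" "q < 1"
  shows "bernoulli_div (1 / 2) q = - ln (2 * sqrt (q * (1 - q)))"
proof -
  have half: "ln (1 / 2 / x) = - ln 2 - ln x" if "0 < x" for x :: real
    using that by (simp add: ln_div ln_mult)
  have "bernoulli_div (1 / 2) q = 1 / 2 * (- ln 2 - ln q) + (1 - 1 / 2) * (- ln 2 - ln (1 - q))"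
    using assms half[of q] half[of "1 - q"] by (simp add: bernoulli_div_def)
  moreover have "ln (2 * sqrt (q * (1 - q))) = ln 2 + (ln q + ln (1 - q)) / 2"
    using assms by (simp add: ln_mult ln_sqrt)
  ultimately show ?thesis
    by (simp add: field_simps)
qed

text \<open>
  The choice \<open>\<sigma> = 1/2\<close>, \<open>\<epsilon> = 2/p\<close>: only the four digits \<open>0, 1, p - 2, p - 1\<close> are bad, and for
  \<open>b = \<epsilon> (p - k)\<close> the exponent \<open>s\<close> minimising \<open>(4 + (p - 4) b powr (- s)) * b powr (s / 2)\<close> satisfies
  \<open>b powr s = (p - 4) / 4\<close>.
\<close>

lemma missing_digits_decay_explicit:
  fixes p k :: nat
  defines "\<epsilon> \<equiv> 2 / real p"
  defines "lam \<equiv> bernoulli_div (1 / 2) (1 - 2 * \<epsilon>) / ln (real p)"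
  defines "\<Delta> \<equiv> 1 / 2 * (ln (\<epsilon> * (real p - real k)) / ln (real p))"
  assumes k: "k \<ge> 1" and p: "p > 8" "p > 4 * k"
  shows "lam \<in> {0<..<1}" "\<Delta> \<in> {0<..<1}"
    and "missing_digits_measure p k \<mu> \<Longrightarrow> fourier_decay_off_sparse \<mu> lam \<Delta>"
proof -
  define r where "r = real p"
  define b where "b = \<epsilon> * (r - real k)"
  \<comment> \<open>\<open>w\<close> is \<open>r powr (- lam)\<close>, by
    \<open>bernoulli_div_half\<close>.\<close>
  define w where "w = 2 * sqrt ((1 - 2 * \<epsilon>) * (2 * \<epsilon>))"
  have r: "r > 8" "r > 4 * real k"
    using p by (simp_all add: r_def)
  then have rk: "r - real k > 0"
    by linarith
  have lnr: "ln r > 0"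
    using r by simp
  have q: "0 < 1 - 2 * \<epsilon>" "0 < \<epsilon>"
    using r by (simp_all add: \<epsilon>_def flip: r_def)
  have "2 * r < r * r"
    using r by (intro mult_strict_right_mono) auto
  then have "2 * (r - real k) < r * r"
    by (simp add: right_diff_distrib)
  then have b: "1 < b" "b < r"
    using r by (simp_all add: b_def \<epsilon>_def pos_divide_less_eq pos_less_divide_eq flip: r_def)
  then have lnb: "0 < ln b" "ln b < ln r"
    by simp_all
  have w: "0 < w"
    using q by (simp add: w_def)
  have w_sq: "(r * w)\<^sup>2 = 16 * (r - 4)"
    using q r by (simp add: w_def power_mult_distrib)
      (simp add: \<epsilon>_def field_simps power2_eq_square flip: r_def)
  have lam_eq: "lam = - ln w / ln r"
    using q bernoulli_div_half[of "1 - 2 * \<epsilon>"] by (simp add: lam_def w_def flip: r_def)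
  then have r_lam: "r powr (- lam) = w"
    using lnr w r by (simp add: powr_def)
  have \<Delta>_eq: "\<Delta> * ln r = ln b / 2"
    using lnr by (simp add: \<Delta>_def b_def flip: r_def)
  \<comment> \<open>Equality at \<open>r = 8\<close> would be the case
    \<open>1 - 2 * \<epsilon> = 1 / 2\<close> of zero entropy; beyond it \<open>w < 1\<close>, that
    is \<open>lam > 0\<close>. Below, \<open>1 < r * w\<close> gives \<open>lam < 1\<close>.\<close>
  have "0 < (r - 8)\<^sup>2"
    using r by simp
  then have "(r * w)\<^sup>2 < r\<^sup>2"
    unfolding w_sq by (simp add: power2_eq_square algebra_simps)
  then have w1: "w < 1"
    using r w power2_less_imp_less[of "r * w" r] by simp
  have "1\<^sup>2 < (r * w)\<^sup>2"
    using r by (simp add: w_sq)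
  then have "1 < r * w"
    using r w by (intro power2_less_imp_less[of 1 "r * w"]) auto
  then have "0 < ln (r * w)"
    by simp
  then have "0 < ln r + ln w"
    using r w by (simp add: ln_mult)
  then show lam: "lam \<in> {0<..<1}"
    using w w1 lnr by (simp_all add: lam_eq divide_neg_pos field_simps)
  show \<Delta>: "\<Delta> \<in> {0<..<1}"
    using lnb lnr by (simp_all add: \<Delta>_def field_simps flip: r_def b_def)
  assume "missing_digits_measure p k \<mu>"
  then obtain D where D: "D \<subseteq> {0..<p}" "card D = p - k" "p - k \<ge> 2" "\<mu> = digit_law p D"
    by (auto simp: missing_digits_measure_def)
  define s where "s = ln ((r - 4) / 4) / ln b"
  define c where "c = (1 / (2 * \<epsilon>) + real k) / (r - real k)"
  have s: "0 < s"
    using r lnb by (simp add: s_def)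
  have b_s: "b powr s = (r - 4) / 4"
    using b lnb r by (simp add: s_def powr_def)
  have c0: "0 < c"
    using r q by (auto simp: c_def intro!: divide_pos_pos add_pos_nonneg)
  \<comment> \<open>The bound \<open>c\<close> from \<open>digit_factor_le\<close> is strictly below
    \<open>1 / b\<close> because \<open>r > 4 * k\<close>; this strictness is what produces the
    gap.\<close>
  have "c * b = (1 / (2 * \<epsilon>) + real k) * \<epsilon>"
    using rk by (simp add: c_def b_def)
  also have "\<dots> = 1 / 2 + 2 * real k / r"
    using r by (simp add: field_simps \<epsilon>_def flip: r_def)
  also have "\<dots> < 1"
    using r by (simp add: field_simps)
  finally have "(c * b) powr s < 1 powr s"
    using c0 b s by (intro powr_less_mono2) auto
  then have c_s: "(r - 4) * c powr s < 4"
    using r by (simp add: powr_mult b_s field_simps)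
  \<comment> \<open>A digit is good if \<open>2 \<le> a\<close> and \<open>a + 3 \<le> p\<close>:
    then \<open>(a + t) / p\<close> lies in \<open>[2 / p, 1 - 2 / p]\<close> for every
    \<open>t\<close> in \<open>[0, 1)\<close>. On the four others the trivial bound 1 is
    used.\<close>
  have card_bad: "card ({..<p} - {2..<p - 2}) = 4"
    using p by (subst card_Diff_subset) auto
  have "(\<Sum>a<p. digit_factor D ((real a + t) / real p) powr s) \<le> 4 + (r - 4) * c powr s"
    if t: "0 \<le> t" "t < 1" for t
  proof -
    let ?F = "\<lambda>a. digit_factor D ((real a + t) / real p) powr s"
    have "(\<Sum>a<p. ?F a) = (\<Sum>a\<in>{..<p} - {2..<p - 2}. ?F a) + (\<Sum>a\<in>{2..<p - 2}. ?F a)"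
      by (rule sum.subset_diff) auto
    also have "\<dots> \<le> (\<Sum>a\<in>{..<p} - {2..<p - 2}. 1) + (\<Sum>a\<in>{2..<p - 2}. c powr s)"
    proof (intro add_mono sum_mono)
      show "?F a \<le> 1" for a
        using s powr_mono2[of s _ 1] by (simp add: digit_factor_nonneg digit_factor_le_1)
      fix a assume a: "a \<in> {2..<p - 2}"
      then have "2 \<le> real a" "real a + 3 \<le> r"
        by (auto simp: r_def)
      then have "2 / r \<le> (real a + t) / r" "(real a + t) / r \<le> (r - 2) / r"
        using t r by (auto intro!: divide_right_mono)
      then have "\<epsilon> \<le> (real a + t) / real p" "(real a + t) / real p \<le> 1 - \<epsilon>"
        using r by (simp_all add: \<epsilon>_def diff_divide_distrib flip: r_def)
      then have "digit_factor D ((real a + t) / real p) \<le> c"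
        unfolding c_def r_def using p D q by (intro digit_factor_le) auto
      then show "?F a \<le> c powr s"
        using s by (intro powr_mono2) (auto simp: digit_factor_nonneg)
    qed
    also have "\<dots> = 4 + (r - 4) * c powr s"
      using p card_bad by (simp add: r_def of_nat_diff)
    finally show ?thesis .
  qed
  \<comment> \<open>Both sides are multiples of \<open>sqrt ((r - 4) / 4)\<close>: the right one by
    exactly 8, the left one by 4 from the bad digits plus less than 4 from the good ones.\<close>
  moreover have "real p powr (\<Delta> * s) * (4 + (r - 4) * c powr s) < real p powr (1 - lam)"
  proof -
    have "ln (r powr (\<Delta> * s)) = s * (\<Delta> * ln r)"
      using r by (simp add: ln_powr)
    also have "\<dots> = ln ((r - 4) / 4) / 2"
      unfolding \<Delta>_eq using lnb by (simp add: s_def)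
    also have "\<dots> = ln (sqrt ((r - 4) / 4))"
      using r by (simp add: ln_sqrt)
    finally have "r powr (\<Delta> * s) = sqrt ((r - 4) / 4)"
      by (rule ln_inj_iff[THEN iffD1, rotated 2]) (use r in simp_all)
    moreover have "r * w = 8 * sqrt ((r - 4) / 4)"
    proof (rule power2_eq_imp_eq)
      show "(r * w)\<^sup>2 = (8 * sqrt ((r - 4) / 4))\<^sup>2"
        unfolding w_sq using r by (simp add: power_mult_distrib)
    qed (use r w in simp_all)
    moreover have "r powr (1 - lam) = r * w"
      using r powr_add[of r 1 "- lam"] by (simp add: r_lam)
    moreover have "sqrt ((r - 4) / 4) * (4 + (r - 4) * c powr s) < sqrt ((r - 4) / 4) * 8"
      using c_s r by (intro mult_strict_left_mono) auto
    ultimately show ?thesis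
      unfolding r_def[symmetric] by simp
  qed
  ultimately show "fourier_decay_off_sparse \<mu> lam \<Delta>"
    unfolding D(4) using D p s \<Delta> lam
    by (intro fourier_decay_off_sparse_digit_law[where s = s]) (auto intro: finite_subset)
qed

theorem theorem7p1:
  "(\<forall>(p :: nat) (k :: nat) (\<mu> :: real measure).
      p > 2 \<and> k \<ge> 1 \<and> missing_digits_measure p k \<mu> \<longrightarrow>
      (\<exists>lam\<in>{0<..<1}. \<exists>\<Delta>\<in>{0<..<1}. fourier_decay_off_sparse \<mu> lam \<Delta>))
   \<and>
   (\<forall>k :: nat. k \<ge> 1 \<longrightarrow>
      (\<forall>\<^sub>F p in sequentially.
        \<exists>\<sigma>\<in>{0<..<1 :: real}. \<exists>\<epsilon>\<in>{0<..<1 :: real}.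
          1 \<le> \<epsilon> * real p \<and> \<epsilon> * real p \<le> real p - 1 \<and> 2 * \<epsilon> * real k < 1 \<and>
          (\<exists>lam\<in>{0<..<1}. \<exists>\<Delta>\<in>{0<..<1}.
             lam = bernoulli_div \<sigma> (1 - 2 * \<epsilon>) / ln (real p) \<and>
             \<Delta> = \<sigma> * (ln (\<epsilon> * (real p - real k)) / ln (real p)) \<and>
             (\<forall>\<mu>. missing_digits_measure p k \<mu> \<longrightarrow> fourier_decay_off_sparse \<mu> lam \<Delta>))))"
proof (intro conjI allI impI)
  fix k :: nat assume k: "k \<ge> 1"
  \<comment> \<open>\<open>p > 8\<close> keeps \<open>lam\<close> positive; \<open>p > 4 * k\<close>
    is the condition \<open>2 * \<epsilon> * k < 1\<close> for
    \<open>\<epsilon> = 2 / p\<close>.\<close>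
  have "\<forall>\<^sub>F p in sequentially. p > 8 \<and> p > 4 * k"
    by (intro eventually_conj eventually_gt_at_top)
  then show "\<forall>\<^sub>F p in sequentially.
        \<exists>\<sigma>\<in>{0<..<1 :: real}. \<exists>\<epsilon>\<in>{0<..<1 :: real}.
          1 \<le> \<epsilon> * real p \<and> \<epsilon> * real p \<le> real p - 1 \<and> 2 * \<epsilon> * real k < 1 \<and>
          (\<exists>lam\<in>{0<..<1}. \<exists>\<Delta>\<in>{0<..<1}.
             lam = bernoulli_div \<sigma> (1 - 2 * \<epsilon>) / ln (real p) \<and>
             \<Delta> = \<sigma> * (ln (\<epsilon> * (real p - real k)) / ln (real p)) \<and>
             (\<forall>\<mu>. missing_digits_measure p k \<mu> \<longrightarrow> fourier_decay_off_sparse \<mu> lam \<Delta>))"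
  proof eventually_elim
    case (elim p)
    then have p: "p > 8" "p > 4 * k" "4 * real k < real p"
      by auto
    note explicit = missing_digits_decay_explicit[OF k p(1,2)]
    show ?case
    proof (rule bexI[of _ "1 / 2"], rule bexI[of _ "2 / real p"], intro conjI)
      show "1 \<le> 2 / real p * real p" "2 / real p * real p \<le> real p - 1"
        using p by simp_all
      show "2 * (2 / real p) * real k < 1"
        using p by simp
      show "\<exists>lam\<in>{0<..<1}. \<exists>\<Delta>\<in>{0<..<1}.
          lam = bernoulli_div (1 / 2) (1 - 2 * (2 / real p)) / ln (real p) \<and>
          \<Delta> = 1 / 2 * (ln (2 / real p * (real p - real k)) / ln (real p)) \<and>
          (\<forall>\<mu>. missing_digits_measure p k \<mu> \<longrightarrow> fourier_decay_off_sparse \<mu> lam \<Delta>)"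
        by (rule bexI conjI refl allI impI explicit | assumption)+
    qed (use p in simp_all)
  qed
qed (use missing_digits_decay in blast)

end
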